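(* Let $n,k\ge 1$ and let $H=[H_{ij}]_{i,j=1}^n\in \mathbb{M}_n(\mathbb{M}_k)$ be positive semidefinite. Then for every positive integer $r$, $$\left(\frac{\det\bigl[s_r(H_{ij})\bigr]_{i,j=1}^n}{\binom{k+r-1}{r}^{n}}\right)^k\ \ge\ (\det H)^r .$$
   Context: $\mathbb{M}_k$ denotes the set of $k\times k$ complex matrices. $\mathbb{M}_n(\mathbb{M}_k)$ denotes the set of complex $nk\times nk$ matrices partitioned into $n\times n$ blocks, each block $H_{ij}$ being a $k\times k$ matrix. "Positive semidefinite" refers to $H$ as an $nk\times nk$ complex (Hermitian) matrix. For $A\in\mathbb{M}_k$ with eigenvalues $\lambda_1(A),\dots,\lambda_k(A)$ (counted with algebraic multiplicity), $s_r(A)$ is the $r$-th complete symmetric polynomial of the eigenvalues: $$s_r(A)=\sum_{1\le i_1\le i_2\le\cdots\le i_r\le k}\lambda_{i_1}(A)\lambda_{i_2}(A)\cdots\lambda_{i_r}(A).$$ $[s_r(H_{ij})]_{i,j=1}^n$ is the $n\times n$ complex matrix whose $(i,j)$ entry is $s_r(H_{ij})$. *)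

theory Defs
  imports
    "HOL-Library.Complex_Order"
    "Jordan_Normal_Form.Char_Poly"
    "Jordan_Normal_Form.Schur_Decomposition"
begin

(* \<le> on complex is the order of HOL-Library.Complex_Order: z \<le> w iff w - z is a
   nonnegative real, so in particular 0 \<le> z says that z is real. *)
definition positive_semidefinite :: "complex mat \<Rightarrow> bool" where
  "positive_semidefinite A \<longleftrightarrow>
     square_mat A \<and> mat_adjoint A = A \<and>
     (\<forall>v \<in> carrier_vec (dim_row A). 0 \<le> (A *\<^sub>v v) \<bullet>c v)"

(* Indices are 0-based: block (i, j) of a matrix partitioned into k x k blocks. *)
definition block :: "nat \<Rightarrow> 'a mat \<Rightarrow> nat \<Rightarrow> nat \<Rightarrow> 'a mat" where
  "block k H i j = mat k k (\<lambda>(a, b). H $$ (i * k + a, j * k + b))"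

(* The eigenvalues with algebraic multiplicity, listed in some order; the list is
   determined up to permutation, and only symmetric functions of it are used. *)
definition eigvals :: "complex mat \<Rightarrow> complex list" where
  "eigvals A = (SOME es. char_poly A = (\<Prod>e\<leftarrow>es. [:- e, 1:]))"

lemma char_poly_eigvals:
  assumes "A \<in> carrier_mat n n"
  shows "char_poly A = (\<Prod>e\<leftarrow>eigvals A. [:- e, 1:])"
  using char_poly_factorized[OF assms] unfolding eigvals_def by (auto intro: someI_ex)

lemma length_eigvals:
  assumes "A \<in> carrier_mat n n"
  shows "length (eigvals A) = n"
proof -
  have "degree (\<Prod>e\<leftarrow>es. [:- e, 1:]) = length es" for es :: "complex list"
    by (rule degree_linear_factors)
  then show ?thesis
    using char_poly_eigvals[OF assms] degree_monic_char_poly[OF assms] by metis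
qed

definition complete_symmetric :: "nat \<Rightarrow> 'a :: comm_ring_1 list \<Rightarrow> 'a" where
  "complete_symmetric r xs =
     (\<Sum>idx | length idx = r \<and> sorted idx \<and> set idx \<subseteq> {..<length xs}. \<Prod>i\<leftarrow>idx. xs ! i)"

definition s_eig :: "nat \<Rightarrow> complex mat \<Rightarrow> complex" where
  "s_eig r A = complete_symmetric r (eigvals A)"

end

(*
  The complete symmetric polynomial s_r of the eigenvalues is the trace of the r-th symmetric
  power, a multiplicative functor on matrices. Factor H = T* T with T upper triangular and let T_j
  be its j-th block column, so that H_ij = T_i* T_j. Then s_r(H_ij) is the Hilbert-Schmidt inner
  product of the symmetric powers of T_i and T_j, and [s_r(H_ij)] is a Gram matrix. In the rows
  of the symmetric power which only involve the i-th block of coordinates, the vectors with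
  j < i vanish because T is block triangular, while the i-th vector restricts to the symmetric
  power of the diagonal block T_ii. A Gram-Schmidt argument therefore gives
  det [s_r(H_ij)] >= PROD_i s_r(T_ii* T_ii). The inequality of arithmetic and geometric means,
  applied to the monomials of s_r, bounds each factor by det (T_ii* T_ii), and the product
  of these determinants is det H.
*)
theory Submission
  imports Defs "HOL-Analysis.Convex"
begin

subsection \<open>Complete symmetric polynomials\<close>

text \<open>By orbit-stabiliser, each orbit of index functions under
  \<open>{..<r}\<close>-permutations accounts for exactly r! pairs. Orbits correspond to monomials
  of degree r, so a sum over pairs counts every monomial equally often, without multinomial weights.
  The same pairs survive in the trace of the symmetric power of a triangular matrix.\<close>

definition stab_pairs :: "nat \<Rightarrow> nat \<Rightarrow> ((nat \<Rightarrow> nat) \<times> (nat \<Rightarrow> nat)) set" where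
  "stab_pairs r k =
     {(f, \<sigma>). f \<in> {..<r} \<rightarrow>\<^sub>E {..<k} \<and> \<sigma> permutes {..<r} \<and> f \<circ> \<sigma> = f}"

lemma finite_stab_pairs: "finite (stab_pairs r k)"
proof (rule finite_subset)
  show "stab_pairs r k \<subseteq> ({..<r} \<rightarrow>\<^sub>E {..<k}) \<times> {\<sigma>. \<sigma> permutes {..<r}}"
    by (auto simp: stab_pairs_def)
qed (intro finite_cartesian_product finite_PiE finite_permutations; simp)

lemma comp_permutes_in_PiE:
  assumes "\<pi> permutes S" "f \<in> S \<rightarrow>\<^sub>E A"
  shows "f \<circ> \<pi> \<in> S \<rightarrow>\<^sub>E A"
proof (rule PiE_I)
  fix x assume "x \<in> S"
  then show "(f \<circ> \<pi>) x \<in> A" using assms permutes_in_image[OF assms(1)] by auto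
next
  fix x assume "x \<notin> S"
  then show "(f \<circ> \<pi>) x = undefined" using assms permutes_not_in[OF assms(1)] by auto
qed

(* A pair (f, sigma) with f o sigma = f is encoded by the sorted value list of f together
   with a permutation: each f is its sorted list composed with a chosen permutation, and
   sigma ranges over the stabiliser of f. *)
lemma complete_symmetric_stab_pairs:
  fixes xs :: "'a :: {comm_ring_1, semiring_char_0} list"
  shows "fact r * complete_symmetric r xs =
    (\<Sum>(f, \<sigma>) \<in> stab_pairs r (length xs). \<Prod>i<r. xs ! (f i))"
proof -
  define k where "k = length xs"
  define I where "I = {idx :: nat list. length idx = r \<and> sorted idx \<and> set idx \<subseteq> {..<k}}"
  define P where "P = {\<pi>. \<pi> permutes {..<r}}"
  define L where "L f = sort (map f [0..<r])" for f :: "nat \<Rightarrow> nat"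
  \<comment> \<open>The value \<open>undefined\<close> outside \<open>{..<r}\<close> makes
    \<open>F idx\<close> extensional, so that it lies in the \<open>PiE\<close> set and equalities
    of functions hold at every argument.\<close>
  define F where "F idx = (\<lambda>i. if i < r then idx ! i else undefined)" for idx :: "nat list"
  define \<pi>0 where "\<pi>0 f = (SOME \<pi>. \<pi> permutes {..<r} \<and> F (L f) \<circ> \<pi> = f)" for f
  have ex: "\<exists>\<pi>. \<pi> permutes {..<r} \<and> F (L f) \<circ> \<pi> = f" if f: "f \<in> {..<r} \<rightarrow>\<^sub>E {..<k}" for f
  proof -
    have "mset (map f [0..<r]) = mset (L f)" by (simp add: L_def)
    then obtain p where p: "p permutes {..<length (L f)}" "permute_list p (L f) = map f [0..<r]"
      by (rule mset_eq_permutation)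
    have len: "length (L f) = r" by (simp add: L_def)
    have "(F (L f) \<circ> p) i = f i" for i
    proof (cases "i < r")
      case True
      then have "p i < r" using p(1) len permutes_in_image[of p "{..<r}" i] by auto
      moreover have "L f ! p i = f i"
        using arg_cong[OF p(2), of "\<lambda>l. l ! i"] True len p(1) by (simp add: permute_list_nth)
      ultimately show ?thesis by (simp add: F_def)
    next
      case False
      then have "p i = i" using p(1) len by (auto intro: permutes_not_in)
      moreover have "f i = undefined" using f False by auto
      ultimately show ?thesis using False by (simp add: F_def)
    qed
    then have "F (L f) \<circ> p = f" by (rule ext)
    then show ?thesis using p(1) len by metis
  qed
  have \<pi>0: "\<pi>0 f permutes {..<r}" "F (L f) \<circ> \<pi>0 f = f" if "f \<in> {..<r} \<rightarrow>\<^sub>E {..<k}" for f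
    using someI_ex[OF ex[OF that]] unfolding \<pi>0_def by auto
  have F_mem: "F m \<in> {..<r} \<rightarrow>\<^sub>E {..<k}" if "m \<in> I" for m
    using that by (simp add: I_def F_def PiE_iff extensional_def subset_iff)
  have LF: "L (F m \<circ> \<pi>) = m" if m: "m \<in> I" and \<pi>: "\<pi> permutes {..<r}" for m \<pi>
  proof -
    have len: "length m = r" using m by (simp add: I_def)
    have "permute_list \<pi> m = map (F m \<circ> \<pi>) [0..<r]"
      using len \<pi> permutes_in_image[OF \<pi>]
      by (intro nth_equalityI) (auto simp: permute_list_def F_def)
    then have "mset m = mset (map (F m \<circ> \<pi>) [0..<r])"
      using \<pi> len mset_permute_list[of \<pi> m] by simp
    then show ?thesis
      using m unfolding L_def I_def by (metis (mono_tags, lifting) mem_Collect_eq properties_for_sort)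
  qed
  have L_mem: "L f \<in> I" if "f \<in> {..<r} \<rightarrow>\<^sub>E {..<k}" for f
  proof -
    have "f i < k" if "i < r" for i using PiE_mem[OF \<open>f \<in> _\<close>, of i] that by simp
    then show ?thesis by (auto simp: I_def L_def)
  qed
  have "(\<Sum>(f, \<sigma>) \<in> stab_pairs r k. \<Prod>i<r. xs ! (f i)) =
        (\<Sum>(m, \<pi>) \<in> I \<times> P. \<Prod>i\<leftarrow>m. xs ! i)"
  \<comment> \<open>From the image of \<open>(f, \<sigma>)\<close>, first \<open>f\<close> is
    recovered as \<open>F m \<circ> \<pi>\<close>, because \<sigma> fixes \<open>f\<close>; then
    \<sigma> is recovered by cancelling the chosen permutation \<open>\<pi>0 f\<close>.\<close>
  proof (rule sum.reindex_bij_witness[where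
        j = "\<lambda>(f, \<sigma>). (L f, \<pi>0 f \<circ> \<sigma>)" and
        i = "\<lambda>(m, \<pi>). (F m \<circ> \<pi>, inv_into UNIV (\<pi>0 (F m \<circ> \<pi>)) \<circ> \<pi>)"], goal_cases)
    case (1 a)
    obtain f \<sigma> where a: "a = (f, \<sigma>)" by force
    have f: "f \<in> {..<r} \<rightarrow>\<^sub>E {..<k}" and \<sigma>: "\<sigma> permutes {..<r}" "f \<circ> \<sigma> = f"
      using 1 by (simp_all add: a stab_pairs_def)
    have "F (L f) \<circ> (\<pi>0 f \<circ> \<sigma>) = f" using \<pi>0(2)[OF f] \<sigma>(2) by (simp add: comp_assoc[symmetric])
    moreover have "inv_into UNIV (\<pi>0 f) \<circ> (\<pi>0 f \<circ> \<sigma>) = \<sigma>"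
      using permutes_inv_o(2)[OF \<pi>0(1)[OF f]] by (simp add: comp_assoc[symmetric])
    ultimately show ?case by (simp add: a)
  next
    case (2 a)
    then show ?case
      by (auto simp: stab_pairs_def P_def intro!: L_mem permutes_compose \<pi>0(1))
  next
    case (3 b)
    then obtain m \<pi> where b: "b = (m, \<pi>)" and m: "m \<in> I" and \<pi>: "\<pi> permutes {..<r}"
      by (auto simp: P_def)
    define f where "f = F m \<circ> \<pi>"
    have f: "f \<in> {..<r} \<rightarrow>\<^sub>E {..<k}"
      unfolding f_def by (rule comp_permutes_in_PiE[OF \<pi> F_mem[OF m]])
    have "\<pi>0 f \<circ> (inv_into UNIV (\<pi>0 f) \<circ> \<pi>) = \<pi>"
      using permutes_inv_o(1)[OF \<pi>0(1)[OF f]] by (simp add: comp_assoc[symmetric])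
    then show ?case using LF[OF m \<pi>] by (simp add: b f_def)
  next
    case (4 b)
    then obtain m \<pi> where b: "b = (m, \<pi>)" and m: "m \<in> I" and \<pi>: "\<pi> permutes {..<r}"
      by (auto simp: P_def)
    define f where "f = F m \<circ> \<pi>"
    have f: "f \<in> {..<r} \<rightarrow>\<^sub>E {..<k}"
      unfolding f_def by (rule comp_permutes_in_PiE[OF \<pi> F_mem[OF m]])
    have "F m \<circ> \<pi>0 f = f" using \<pi>0(2)[OF f] LF[OF m \<pi>] by (simp add: f_def)
    then have "f \<circ> inv_into UNIV (\<pi>0 f) = F m"
      using permutes_inv_o(1)[OF \<pi>0(1)[OF f]] by (metis comp_assoc comp_id)
    then have "f \<circ> (inv_into UNIV (\<pi>0 f) \<circ> \<pi>) = f" by (simp add: comp_assoc[symmetric] f_def)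
    moreover have "inv_into UNIV (\<pi>0 f) \<circ> \<pi> permutes {..<r}"
      by (rule permutes_compose[OF \<pi> permutes_inv[OF \<pi>0(1)[OF f]]])
    ultimately show ?case using f by (simp add: b f_def stab_pairs_def)
  next
    case (5 a)
    then obtain f \<sigma> where a: "a = (f, \<sigma>)" by force
    have "(\<Prod>i\<leftarrow>L f. xs ! i) = prod_mset (image_mset ((!) xs) (mset (map f [0..<r])))"
      by (simp add: L_def flip: prod_mset_prod_list)
    also have "\<dots> = (\<Prod>i\<leftarrow>[0..<r]. xs ! (f i))"
      by (simp add: multiset.map_comp comp_def prod_mset_prod_list flip: mset_map)
    also have "\<dots> = (\<Prod>i<r. xs ! (f i))"
      by (metis (no_types) atLeast_upt distinct_upt prod.distinct_set_conv_list)
    finally show ?case by (simp add: a)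
  qed
  also have "\<dots> = (\<Sum>m\<in>I. \<Sum>\<pi>\<in>P. \<Prod>i\<leftarrow>m. xs ! i)"
    by (rule sum.cartesian_product[symmetric])
  also have "\<dots> = of_nat (card P) * (\<Sum>m\<in>I. \<Prod>i\<leftarrow>m. xs ! i)"
    by (simp add: sum_distrib_left)
  also have "card P = fact r"
    unfolding P_def using card_permutations[of "{..<r}" r] by simp
  also have "(\<Sum>m\<in>I. \<Prod>i\<leftarrow>m. xs ! i) = complete_symmetric r xs"
    by (simp add: complete_symmetric_def I_def k_def)
  finally show ?thesis by (simp add: k_def)
qed

text \<open>Setting all variables to 1 in the preceding identity turns both sides into counts; the
  number of monomials is the number of multisets of size r from k elements.\<close>

lemma card_stab_pairs: "card (stab_pairs r k) = fact r * ((k + r - 1) choose r)"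
proof -
  define I where "I = {idx :: nat list. length idx = r \<and> sorted idx \<and> set idx \<subseteq> {..<k}}"
  have "bij_betw mset I (multisets_of_size {..<k} r)"
    by (rule bij_betw_byWitness[where f' = sorted_list_of_multiset])
       (auto simp: I_def multisets_of_size_def sorted_sort_id simp flip: size_mset)
  then have card_I: "card I = (k + r - 1) choose r"
    by (simp add: bij_betw_same_card card_multisets_of_size)
  have one: "(\<Prod>i\<leftarrow>m. replicate k (1::int) ! i) = 1" if "m \<in> I" for m
  proof -
    have "map ((!) (replicate k (1::int))) m = replicate (length m) 1"
      using that by (intro nth_equalityI) (auto simp: I_def subset_iff)
    then show ?thesis by simp
  qed
  have "int (fact r * card I) = fact r * complete_symmetric r (replicate k (1::int))"
    using one by (simp add: complete_symmetric_def flip: I_def)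
  also have "\<dots> = (\<Sum>(f, \<sigma>) \<in> stab_pairs r k. \<Prod>i<r. replicate k (1::int) ! (f i))"
    using complete_symmetric_stab_pairs[of r "replicate k (1::int)"] by simp
  also have "\<dots> = (\<Sum>(f, \<sigma>) \<in> stab_pairs r k. 1)"
    by (intro sum.cong refl) (auto simp: stab_pairs_def PiE_iff intro!: prod.neutral)
  also have "\<dots> = int (card (stab_pairs r k))" by simp
  finally show ?thesis unfolding card_I by linarith
qed

section \<open>The arithmetic-geometric mean inequality for complete symmetric polynomials\<close>

lemma mod_shift_back:
  fixes x :: nat
  assumes "x < k" "t + u = k"
  shows "((x + t) mod k + u) mod k = x"
proof -
  have "((x + t) mod k + u) mod k = (x + k) mod k"
    by (simp only: mod_add_left_eq add.assoc assms(2))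
  then show ?thesis using assms(1) by simp
qed

text \<open>The mean of the monomials over \<open>stab_pairs\<close> is s_r divided by the number of
  monomials. All variables occur equally often in the product of these monomials, which identifies
  the geometric mean. Raising to the power k avoids fractional exponents in the statement.\<close>

lemma complete_symmetric_amgm:
  fixes xs :: "real list"
  assumes nn: "\<And>x. x \<in> set xs \<Longrightarrow> 0 \<le> x" and len: "length xs = k" and k: "k \<ge> 1"
  shows "(complete_symmetric r xs / ((k + r - 1) choose r)) ^ k \<ge> prod_list xs ^ r"
proof -
  define Z where "Z = stab_pairs r k"
  define y where "y = (\<lambda>(f, \<sigma> :: nat \<Rightarrow> nat). \<Prod>i<r. xs ! (f i))"
  define N where "N = (k + r - 1) choose r"
  have Npos: "N > 0" using k by (auto simp: N_def)
  have cZ: "card Z = fact r * N" by (simp add: Z_def N_def card_stab_pairs)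
  have cZpos: "card Z > 0" using cZ Npos by simp
  have fin: "finite Z" by (simp add: Z_def finite_stab_pairs)
  have ynn: "y z \<ge> 0" if "z \<in> Z" for z
    using that nn len by (auto simp: y_def Z_def stab_pairs_def PiE_iff intro!: prod_nonneg)
  have sum_y: "(\<Sum>z\<in>Z. y z / card Z) = complete_symmetric r xs / N"
  proof -
    have "(\<Sum>z\<in>Z. y z) = fact r * complete_symmetric r xs"
      unfolding complete_symmetric_stab_pairs y_def Z_def len by simp
    then show ?thesis using Npos by (simp add: cZ flip: sum_divide_distrib)
  qed
  (* The cyclic shift of values permutes the pairs, and the product over all k shifts of
     one monomial is a power of the full product. *)
  define s where "s t z = (case z of (f, \<sigma> :: nat \<Rightarrow> nat) \<Rightarrow>
      ((\<lambda>i. if i < r then (f i + t) mod k else undefined), \<sigma>))" for t and z :: "(nat \<Rightarrow> nat) \<times> _"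
  have s_mem: "s t z \<in> Z" if "z \<in> Z" for t z
  proof -
    obtain f \<sigma> where z: "z = (f, \<sigma>)" by force
    have f: "f \<in> {..<r} \<rightarrow>\<^sub>E {..<k}" "\<sigma> permutes {..<r}" "f \<circ> \<sigma> = f"
      using that by (auto simp: z Z_def stab_pairs_def)
    have "\<sigma> i < r \<longleftrightarrow> i < r" for i using permutes_in_image[OF f(2), of i] by simp
    moreover have "f (\<sigma> i) = f i" for i using f(3) by (metis comp_apply)
    ultimately show ?thesis using f k
      by (auto simp: s_def z Z_def stab_pairs_def fun_eq_iff)
  qed
  have s_inv: "s u (s t z) = z" if "z \<in> Z" and k_eq: "t + u = k" for t u z
  proof -
    obtain f \<sigma> where z: "z = (f, \<sigma>)" by force
    have "f i < k" if "i < r" for i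
      using \<open>z \<in> Z\<close> that by (auto simp: z Z_def stab_pairs_def)
    then have "((f i + t) mod k + u) mod k = f i" if "i < r" for i
      using that k_eq by (intro mod_shift_back) auto
    moreover have "f i = undefined" if "\<not> i < r" for i
      using \<open>z \<in> Z\<close> that by (auto simp: z Z_def stab_pairs_def)
    ultimately show ?thesis by (auto simp: s_def z fun_eq_iff)
  qed
  have shift: "(\<Prod>z\<in>Z. y (s t z)) = (\<Prod>z\<in>Z. y z)" if "t < k" for t
    by (rule prod.reindex_bij_witness[where i = "s (k - t)" and j = "s t"])
       (use that in \<open>auto simp: s_mem s_inv\<close>)
  have rot: "(\<Prod>t<k. xs ! ((a + t) mod k)) = prod_list xs" if "a < k" for a
  proof -
    have "(\<Prod>t<k. xs ! ((a + t) mod k)) = (\<Prod>t<k. xs ! t)"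
    proof (rule prod.reindex_bij_witness[where i = "\<lambda>t. (t + (k - a)) mod k"
          and j = "\<lambda>t. (a + t) mod k"], goal_cases)
      case (1 t)
      then show ?case using that mod_shift_back[of t k a "k - a"] by (simp add: add.commute)
    next
      case (3 t)
      then show ?case using that mod_shift_back[of t k "k - a" a] by (simp add: add.commute)
    qed (use that in auto)
    then show ?thesis by (simp add: prod.list_conv_set_nth len lessThan_atLeast0)
  qed
  have orbit: "(\<Prod>t<k. y (s t z)) = prod_list xs ^ r" if "z \<in> Z" for z
  proof -
    obtain f \<sigma> where z: "z = (f, \<sigma>)" by force
    have f: "f i < k" if "i < r" for i
      using \<open>z \<in> Z\<close> that by (auto simp: z Z_def stab_pairs_def)
    have "(\<Prod>t<k. y (s t z)) = (\<Prod>t<k. \<Prod>i<r. xs ! ((f i + t) mod k))"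
      by (simp add: y_def s_def z)
    also have "\<dots> = (\<Prod>i<r. \<Prod>t<k. xs ! ((f i + t) mod k))" by (rule prod.swap)
    also have "\<dots> = (\<Prod>i<r. prod_list xs)" using f by (intro prod.cong) (auto simp: rot)
    finally show ?thesis by simp
  qed
  have pk: "(\<Prod>z\<in>Z. y z) ^ k = (prod_list xs ^ r) ^ card Z"
  proof -
    have "(\<Prod>z\<in>Z. y z) ^ k = (\<Prod>t<k. \<Prod>z\<in>Z. y (s t z))" by (simp add: shift)
    also have "\<dots> = (\<Prod>z\<in>Z. \<Prod>t<k. y (s t z))" by (rule prod.swap)
    also have "\<dots> = (prod_list xs ^ r) ^ card Z" by (simp add: orbit)
    finally show ?thesis .
  qed
  have Pnn: "0 \<le> (\<Prod>z\<in>Z. y z)" by (intro prod_nonneg) (auto simp: ynn)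
  have am: "(\<Prod>z\<in>Z. y z) powr (1 / card Z) \<le> complete_symmetric r xs / N"
    using arith_geom_mean[of Z y] fin cZpos ynn unfolding sum_y by fastforce
  \<comment> \<open>A vanishing product is split off, since passing from \<open>powr\<close> to a
    natural power requires a positive base.\<close>
  have "(\<Prod>z\<in>Z. y z) = ((\<Prod>z\<in>Z. y z) powr (1 / card Z)) ^ card Z"
    using Pnn cZpos by (cases "(\<Prod>z\<in>Z. y z) = 0") (auto simp: powr_powr simp flip: powr_realpow)
  also have "\<dots> \<le> (complete_symmetric r xs / N) ^ card Z"
    by (rule power_mono[OF am]) simp
  finally have "(\<Prod>z\<in>Z. y z) ^ k \<le> ((complete_symmetric r xs / N) ^ card Z) ^ k"
    by (rule power_mono) (rule Pnn)
  \<comment> \<open>Both sides are now \<open>card Z\<close>-th powers of nonnegative reals, so this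
    exponent can be cancelled.\<close>
  then have "(prod_list xs ^ r) ^ card Z \<le> ((complete_symmetric r xs / N) ^ k) ^ card Z"
    unfolding pk by (simp add: power_mult[symmetric] mult.commute)
  moreover have "0 \<le> complete_symmetric r xs / N"
    by (rule order_trans[OF _ am]) simp
  moreover have "0 \<le> prod_list xs" using nn by (rule prod_list_nonneg)
  ultimately show ?thesis using cZpos by (simp add: N_def)
qed

subsection \<open>Traces of symmetric powers\<close>

(* r! times the trace of the r-th symmetric power: the trace of the r-th tensor power
   composed with the sum of all permutations of the factors. *)
definition sym_trace :: "nat \<Rightarrow> nat \<Rightarrow> (nat \<Rightarrow> nat \<Rightarrow> complex) \<Rightarrow> complex" where
  "sym_trace r k a = (\<Sum>f \<in> {..<r} \<rightarrow>\<^sub>E {..<k}. \<Sum>\<sigma> | \<sigma> permutes {..<r}. \<Prod>i<r. a (f i) (f (\<sigma> i)))"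

lemma sym_trace_cong:
  assumes "\<And>i j. i < k \<Longrightarrow> j < k \<Longrightarrow> a i j = b i j"
  shows "sym_trace r k a = sym_trace r k b"
  unfolding sym_trace_def
proof (intro sum.cong prod.cong refl)
  fix f \<sigma> i
  assume f: "f \<in> {..<r} \<rightarrow>\<^sub>E {..<k}" and "\<sigma> \<in> {\<sigma>. \<sigma> permutes {..<r}}" and i: "i \<in> {..<r}"
  then have "\<sigma> i \<in> {..<r}" using permutes_in_image[of \<sigma> "{..<r}" i] by simp
  then show "a (f i) (f (\<sigma> i)) = b (f i) (f (\<sigma> i))"
    using PiE_mem[OF f i] PiE_mem[OF f, of "\<sigma> i"] by (intro assms) simp_all
qed

lemma sum_PiE_comp_permutes:
  assumes "\<sigma> permutes S"
  shows "(\<Sum>f \<in> S \<rightarrow>\<^sub>E A. h (f \<circ> \<sigma>)) = (\<Sum>f \<in> S \<rightarrow>\<^sub>E A. h f)"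
proof (rule sum.reindex_bij_witness[where i = "\<lambda>f. f \<circ> inv_into UNIV \<sigma>" and j = "\<lambda>f. f \<circ> \<sigma>"])
qed (use comp_permutes_in_PiE[OF assms] comp_permutes_in_PiE[OF permutes_inv[OF assms]]
      permutes_inv_o[OF assms] in \<open>simp_all add: comp_assoc\<close>)

text \<open>This is the cyclicity of the trace, carried over to symmetric powers; it makes
  \<open>sym_trace\<close> invariant under similarity.\<close>

lemma sym_trace_commute:
  "sym_trace r k (\<lambda>a b. \<Sum>c<k. p a c * q c b) = sym_trace r k (\<lambda>a b. \<Sum>c<k. q a c * p c b)"
proof -
  let ?F = "{..<r} \<rightarrow>\<^sub>E {..<k}" and ?P = "{\<sigma>. \<sigma> permutes {..<r}}"
  define C where "C p f g = (\<Prod>i<r. p (f i) (g i))" for p :: "nat \<Rightarrow> nat \<Rightarrow> complex" and f g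
  have expand: "sym_trace r k (\<lambda>a b. \<Sum>c<k. p a c * q c b) =
      (\<Sum>\<sigma>\<in>?P. \<Sum>f\<in>?F. \<Sum>g\<in>?F. C p f g * C q g (f \<circ> \<sigma>))" for p q
    unfolding sym_trace_def C_def
    by (subst sum.swap) (simp add: prod_sum_PiE prod.distrib)
  have "(\<Sum>f\<in>?F. \<Sum>g\<in>?F. C p f g * C q g (f \<circ> \<sigma>)) = (\<Sum>f\<in>?F. \<Sum>g\<in>?F. C q f g * C p g (f \<circ> \<sigma>))"
    if \<sigma>: "\<sigma> permutes {..<r}" for \<sigma>
  proof -
    \<comment> \<open>Tensor powers commute with permutations of the factors. Replacing
      \<open>g\<close> by \<open>g \<circ> \<sigma>\<close> therefore moves \<sigma> from one factor
      of the summand to the other.\<close>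
    have shift: "C p (f \<circ> \<sigma>) (g \<circ> \<sigma>) = C p f g" for f g
      using prod.permute[OF \<sigma>, of "\<lambda>i. p (f i) (g i)"] by (simp add: C_def comp_def)
    have "(\<Sum>f\<in>?F. \<Sum>g\<in>?F. C q f g * C p g (f \<circ> \<sigma>)) =
          (\<Sum>g\<in>?F. \<Sum>f\<in>?F. C q f g * C p g (f \<circ> \<sigma>))" by (rule sum.swap)
    also have "\<dots> = (\<Sum>g\<in>?F. \<Sum>f\<in>?F. C q f (g \<circ> \<sigma>) * C p (g \<circ> \<sigma>) (f \<circ> \<sigma>))"
      by (rule sum_PiE_comp_permutes[OF \<sigma>, symmetric])
    finally show ?thesis by (simp add: shift mult.commute)
  qed
  then show ?thesis by (simp add: expand)
qed

(* If f o sigma differs from f, then f drops somewhere along sigma, so that the corresponding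
   product contains an entry below the diagonal. *)
lemma sym_trace_triangular:
  assumes ut: "\<And>a b. a < k \<Longrightarrow> b < a \<Longrightarrow> t a b = 0"
  shows "sym_trace r k t = (\<Sum>(f, \<sigma>) \<in> stab_pairs r k. \<Prod>i<r. t (f i) (f i))"
proof -
  let ?F = "{..<r} \<rightarrow>\<^sub>E {..<k}" and ?P = "{\<sigma>. \<sigma> permutes {..<r}}"
  have "sym_trace r k t = (\<Sum>(f, \<sigma>) \<in> ?F \<times> ?P. \<Prod>i<r. t (f i) (f (\<sigma> i)))"
    unfolding sym_trace_def by (rule sum.cartesian_product)
  also have "\<dots> = (\<Sum>(f, \<sigma>) \<in> stab_pairs r k. \<Prod>i<r. t (f i) (f (\<sigma> i)))"
  proof (rule sum.mono_neutral_right)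
    show "finite (?F \<times> ?P)"
      by (intro finite_cartesian_product finite_PiE finite_permutations; simp)
    show "stab_pairs r k \<subseteq> ?F \<times> ?P" unfolding stab_pairs_def by blast
    show "\<forall>z\<in>?F \<times> ?P - stab_pairs r k. (case z of (f, \<sigma>) \<Rightarrow> \<Prod>i<r. t (f i) (f (\<sigma> i))) = 0"
    proof
      fix z assume z: "z \<in> ?F \<times> ?P - stab_pairs r k"
      obtain f \<sigma> where zf: "z = (f, \<sigma>)" by force
      have f: "f \<in> ?F" and \<sigma>: "\<sigma> permutes {..<r}" and ne: "f \<circ> \<sigma> \<noteq> f"
        using z by (simp_all add: zf stab_pairs_def)
      have "\<exists>i<r. f (\<sigma> i) < f i"
      proof (rule ccontr)
        assume "\<not> ?thesis"
        then have le: "f i \<le> f (\<sigma> i)" if "i < r" for i using that by force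
        \<comment> \<open>Permuting the arguments preserves the sum, so the pointwise inequality
          \<open>le\<close> must be an equality everywhere.\<close>
        have "sum f {..<r} = sum (f \<circ> \<sigma>) {..<r}" by (rule sum.permute[OF \<sigma>])
        then have eq: "f i = f (\<sigma> i)" if "i < r" for i
          using sum_mono_inv[of f "{..<r}" "f \<circ> \<sigma>" i] le that by simp
        have "f \<circ> \<sigma> = f"
        proof
          fix i show "(f \<circ> \<sigma>) i = f i"
            using eq[of i] permutes_not_in[OF \<sigma>, of i] by (cases "i < r") simp_all
        qed
        with ne show False by contradiction
      qed
      then obtain i where i: "i < r" "f (\<sigma> i) < f i" by blast
      then have "t (f i) (f (\<sigma> i)) = 0" using PiE_mem[OF f, of i] by (intro ut) simp_all
      then show "(case z of (f, \<sigma>) \<Rightarrow> \<Prod>i<r. t (f i) (f (\<sigma> i))) = 0"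
        using i(1) by (auto simp: zf intro!: prod_zero)
    qed
  qed
  also have "\<dots> = (\<Sum>(f, \<sigma>) \<in> stab_pairs r k. \<Prod>i<r. t (f i) (f i))"
  proof (rule sum.cong[OF refl], clarify)
    fix f \<sigma> assume "(f, \<sigma>) \<in> stab_pairs r k"
    then have "f (\<sigma> i) = f i" for i unfolding stab_pairs_def by (simp add: fun_eq_iff)
    then show "(\<Prod>i<r. t (f i) (f (\<sigma> i))) = (\<Prod>i<r. t (f i) (f i))" by simp
  qed
  finally show ?thesis .
qed

lemma mult_mat_entry:
  fixes A B :: "'a :: semiring_0 mat"
  assumes "A \<in> carrier_mat n m" "B \<in> carrier_mat m l" "i < n" "j < l"
  shows "(A * B) $$ (i, j) = (\<Sum>c<m. A $$ (i, c) * B $$ (c, j))"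
  using assms by (simp add: scalar_prod_def lessThan_atLeast0)

text \<open>Schur triangularisation puts the eigenvalues on the diagonal of a matrix similar to
  \<open>A\<close>. There only the stabilising pairs contribute, and each contributes a monomial in
  the eigenvalues.\<close>

lemma s_eig_sym_trace:
  assumes A: "A \<in> carrier_mat k k"
  shows "fact r * s_eig r A = sym_trace r k (\<lambda>a b. A $$ (a, b))"
proof -
  obtain B P Q where dec: "schur_decomposition A (eigvals A) = (B, P, Q)"
    by (rule prod_cases3)
  note wit = schur_decomposition[OF A char_poly_eigvals[OF A] dec]
  then have B: "B \<in> carrier_mat k k" and P: "P \<in> carrier_mat k k" and Q: "Q \<in> carrier_mat k k"
    and QP: "Q * P = 1\<^sub>m k" and eq: "A = P * B * Q"
    using A unfolding similar_mat_wit_def Let_def by auto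
  have ut: "upper_triangular B" and diag: "diag_mat B = eigvals A" using wit by auto
  have BQ: "B * Q \<in> carrier_mat k k" using B Q by simp
  \<comment> \<open>Similarity is used as a single commutation: the factors \<open>P\<close> and
    \<open>B * Q\<close> are exchanged, and \<open>B * Q * P\<close> is \<open>B\<close>.\<close>
  have "A = P * (B * Q)" using eq P B Q by simp
  then have "sym_trace r k (\<lambda>a b. A $$ (a, b)) =
      sym_trace r k (\<lambda>a b. \<Sum>c<k. P $$ (a, c) * (B * Q) $$ (c, b))"
    using mult_mat_entry[OF P BQ] by (intro sym_trace_cong) simp
  also have "\<dots> = sym_trace r k (\<lambda>a b. \<Sum>c<k. (B * Q) $$ (a, c) * P $$ (c, b))"
    by (rule sym_trace_commute)
  also have "\<dots> = sym_trace r k (\<lambda>a b. B $$ (a, b))"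
  proof (rule sym_trace_cong)
    fix i j assume ij: "i < k" "j < k"
    have "B * Q * P = B" using B Q P QP by simp
    then have "B $$ (i, j) = (B * Q * P) $$ (i, j)" by simp
    also have "\<dots> = (\<Sum>c<k. (B * Q) $$ (i, c) * P $$ (c, j))"
      by (rule mult_mat_entry[OF BQ P ij])
    finally show "(\<Sum>c<k. (B * Q) $$ (i, c) * P $$ (c, j)) = B $$ (i, j)" by simp
  qed
  also have "\<dots> = (\<Sum>(f, \<sigma>) \<in> stab_pairs r k. \<Prod>i<r. B $$ (f i, f i))"
    using ut B by (intro sym_trace_triangular) (auto simp: upper_triangular_def)
  also have "\<dots> = (\<Sum>(f, \<sigma>) \<in> stab_pairs r k. \<Prod>i<r. eigvals A ! (f i))"
  proof (rule sum.cong[OF refl], clarify, rule prod.cong[OF refl])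
    fix f \<sigma> i assume "(f, \<sigma>) \<in> stab_pairs r k" "i \<in> {..<r}"
    then have "f i < k" using PiE_mem[of f "{..<r}" "\<lambda>_. {..<k}" i] by (simp add: stab_pairs_def)
    then show "B $$ (f i, f i) = eigvals A ! (f i)"
      using B by (simp add: diag_mat_def flip: diag)
  qed
  also have "\<dots> = fact r * s_eig r A"
    by (simp add: s_eig_def complete_symmetric_stab_pairs length_eigvals[OF A])
  finally show ?thesis by simp
qed

(* Up to normalisation, the (g, f) entry of the r-th symmetric power of x. *)
definition sym_power :: "nat \<Rightarrow> (nat \<Rightarrow> nat \<Rightarrow> complex) \<Rightarrow> (nat \<Rightarrow> nat) \<Rightarrow> (nat \<Rightarrow> nat) \<Rightarrow> complex" where
  "sym_power r x g f = (\<Sum>\<tau> | \<tau> permutes {..<r}. \<Prod>i<r. x (g i) (f (\<tau> i)))"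

text \<open>By functoriality the symmetric power of X* Y is a product of symmetric powers, so its
  trace is a Hilbert-Schmidt inner product. Symmetrising both arguments costs the extra r!. The row
  set \<open>R\<close> is kept general so that it can be all rows or those of one block.\<close>

lemma sym_trace_gram:
  assumes "finite R"
  shows "fact r * sym_trace r k (\<lambda>a b. \<Sum>p\<in>R. cnj (x p a) * y p b) =
    (\<Sum>(g, f) \<in> ({..<r} \<rightarrow>\<^sub>E R) \<times> ({..<r} \<rightarrow>\<^sub>E {..<k}).
        cnj (sym_power r x g f) * sym_power r y g f)"
proof -
  let ?F = "{..<r} \<rightarrow>\<^sub>E {..<k}" and ?P = "{\<sigma>. \<sigma> permutes {..<r}}" and ?G = "{..<r} \<rightarrow>\<^sub>E R"
  define C where "C x g f = (\<Prod>i<r. x (g i) (f i))" for x :: "nat \<Rightarrow> nat \<Rightarrow> complex" and f g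
  have sp: "sym_power r x g f = (\<Sum>\<tau>\<in>?P. C x g (f \<circ> \<tau>))" for x g f
    by (simp add: sym_power_def C_def)
  have card_P: "card ?P = fact r" using card_permutations[of "{..<r}" r] by simp
  have "sym_trace r k (\<lambda>a b. \<Sum>p\<in>R. cnj (x p a) * y p b) =
      (\<Sum>f\<in>?F. \<Sum>\<sigma>\<in>?P. \<Sum>g\<in>?G. cnj (C x g f) * C y g (f \<circ> \<sigma>))"
    unfolding sym_trace_def C_def by (simp add: prod_sum_PiE assms prod.distrib)
  also have "\<dots> = (\<Sum>f\<in>?F. \<Sum>g\<in>?G. \<Sum>\<sigma>\<in>?P. cnj (C x g f) * C y g (f \<circ> \<sigma>))"
    by (intro sum.cong refl sum.swap)
  also have "\<dots> = (\<Sum>g\<in>?G. \<Sum>f\<in>?F. \<Sum>\<sigma>\<in>?P. cnj (C x g f) * C y g (f \<circ> \<sigma>))"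
    by (rule sum.swap)
  finally have st: "sym_trace r k (\<lambda>a b. \<Sum>p\<in>R. cnj (x p a) * y p b) =
      (\<Sum>g\<in>?G. \<Sum>f\<in>?F. \<Sum>\<sigma>\<in>?P. cnj (C x g f) * C y g (f \<circ> \<sigma>))" .
  have "(\<Sum>f\<in>?F. cnj (sym_power r x g f) * sym_power r y g f) =
      fact r * (\<Sum>f\<in>?F. \<Sum>\<sigma>\<in>?P. cnj (C x g f) * C y g (f \<circ> \<sigma>))" for g
  proof -
    define h where "h f = (\<Sum>\<sigma>\<in>?P. cnj (C x g f) * C y g (f \<circ> \<sigma>))" for f
    have "(\<Sum>f\<in>?F. cnj (sym_power r x g f) * sym_power r y g f) =
        (\<Sum>f\<in>?F. \<Sum>\<rho>\<in>?P. \<Sum>\<tau>\<in>?P. cnj (C x g (f \<circ> \<rho>)) * C y g (f \<circ> \<tau>))"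
      by (simp add: sp sum_product)
    \<comment> \<open>Writing \<tau> as \<open>\<rho> \<circ> \<sigma>\<close> turns the inner sum
      into \<open>h\<close> at \<open>f \<circ> \<rho>\<close>; the sum over \<open>f\<close> then
      no longer depends on \<rho>, which yields the factor r!.\<close>
    also have "\<dots> = (\<Sum>f\<in>?F. \<Sum>\<rho>\<in>?P. h (f \<circ> \<rho>))"
    proof (intro sum.cong refl)
      fix f \<rho> assume "\<rho> \<in> ?P"
      then have \<rho>: "\<rho> permutes {..<r}" by simp
      show "(\<Sum>\<tau>\<in>?P. cnj (C x g (f \<circ> \<rho>)) * C y g (f \<circ> \<tau>)) = h (f \<circ> \<rho>)"
        unfolding h_def using setum_permutations_compose_left[OF \<rho>, of
            "\<lambda>\<tau>. cnj (C x g (f \<circ> \<rho>)) * C y g (f \<circ> \<tau>)"]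
        by (simp add: comp_assoc)
    qed
    also have "\<dots> = (\<Sum>\<rho>\<in>?P. \<Sum>f\<in>?F. h (f \<circ> \<rho>))" by (rule sum.swap)
    also have "\<dots> = (\<Sum>\<rho>\<in>?P. \<Sum>f\<in>?F. h f)"
      by (intro sum.cong refl sum_PiE_comp_permutes) simp
    also have "\<dots> = fact r * (\<Sum>f\<in>?F. h f)" by (simp add: card_P)
    finally show ?thesis by (simp add: h_def)
  qed
  then show ?thesis
    by (simp add: st sum_distrib_left flip: sum.cartesian_product)
qed

subsection \<open>Positive semidefinite matrices\<close>

lemma cscalar_prod_sum:
  fixes A :: "complex mat"
  assumes "A \<in> carrier_mat n n" "v \<in> carrier_vec n" "w \<in> carrier_vec n"
  shows "(A *\<^sub>v v) \<bullet>c w = (\<Sum>i<n. \<Sum>j<n. cnj (w $ i) * A $$ (i, j) * v $ j)"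
  using assms
  by (simp add: scalar_prod_def lessThan_atLeast0 sum_distrib_left sum_distrib_right mult_ac)

lemma cscalar_prod_self:
  fixes v :: "complex vec"
  assumes "v \<in> carrier_vec n"
  shows "v \<bullet>c v = of_real (\<Sum>i<n. (cmod (v $ i))\<^sup>2)"
  using assms
  by (simp add: scalar_prod_def lessThan_atLeast0 complex_norm_square del: of_real_power)

lemma mult_mat_vec_entry:
  fixes A :: "'a :: semiring_0 mat"
  assumes "A \<in> carrier_mat n m" "v \<in> carrier_vec m" "i < n"
  shows "(A *\<^sub>v v) $ i = (\<Sum>j<m. A $$ (i, j) * v $ j)"
  using assms by (simp add: scalar_prod_def lessThan_atLeast0)

lemma of_real_cmod_square: "of_real ((cmod z)\<^sup>2) = cnj z * z"
  by (simp add: complex_norm_square mult.commute del: of_real_power)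

text \<open>The form is kept as an exact squared norm, and not only as a sign, because the Gram
  determinant bound compares it with partial sums over subsets of \<Omega>.\<close>

lemma gram_form:
  fixes v :: "nat \<Rightarrow> 'b \<Rightarrow> complex"
  assumes "x \<in> carrier_vec n"
  shows "(mat n n (\<lambda>(i, j). \<Sum>\<omega>\<in>\<Omega>. cnj (v i \<omega>) * v j \<omega>) *\<^sub>v x) \<bullet>c x
    = of_real (\<Sum>\<omega>\<in>\<Omega>. (cmod (\<Sum>j<n. x $ j * v j \<omega>))\<^sup>2)"
proof -
  have "(mat n n (\<lambda>(i, j). \<Sum>\<omega>\<in>\<Omega>. cnj (v i \<omega>) * v j \<omega>) *\<^sub>v x) \<bullet>c x =
      (\<Sum>i<n. \<Sum>j<n. \<Sum>\<omega>\<in>\<Omega>. cnj (x $ i * v i \<omega>) * (x $ j * v j \<omega>))"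
    by (subst cscalar_prod_sum[OF _ assms assms])
       (auto simp: sum_distrib_left sum_distrib_right mult_ac intro!: sum.cong)
  also have "\<dots> = (\<Sum>i<n. \<Sum>\<omega>\<in>\<Omega>. \<Sum>j<n. cnj (x $ i * v i \<omega>) * (x $ j * v j \<omega>))"
    by (intro sum.cong refl sum.swap)
  also have "\<dots> = (\<Sum>\<omega>\<in>\<Omega>. \<Sum>i<n. \<Sum>j<n. cnj (x $ i * v i \<omega>) * (x $ j * v j \<omega>))"
    by (rule sum.swap)
  also have "\<dots> = (\<Sum>\<omega>\<in>\<Omega>. of_real ((cmod (\<Sum>j<n. x $ j * v j \<omega>))\<^sup>2))"
    by (simp only: of_real_cmod_square cnj_sum sum_product)
  finally show ?thesis by simp
qed

section \<open>Eigenvalues and determinants under lower bounds on the quadratic form\<close>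

text \<open>Testing the form on an eigenvector bounds its eigenvalue. Comparable complex numbers
  have equal imaginary parts, so the same comparison shows that the eigenvalue is real.\<close>

lemma eigvals_bounded_below:
  fixes c :: real
  assumes A: "A \<in> carrier_mat n n"
    and form: "\<And>v. v \<in> carrier_vec n \<Longrightarrow> of_real c * (v \<bullet>c v) \<le> (A *\<^sub>v v) \<bullet>c v"
  obtains xs where "eigvals A = map complex_of_real xs" "length xs = n" "\<And>x. x \<in> set xs \<Longrightarrow> c \<le> x"
proof
  have ge: "of_real c \<le> e" if e: "e \<in> set (eigvals A)" for e
  proof -
    have "poly (char_poly A) e = 0"
      using e by (simp add: char_poly_eigvals[OF A] poly_prod_list_zero_iff image_iff)
    then have "eigenvalue A e" using eigenvalue_root_char_poly[OF A] by simp
    then obtain v where v: "v \<in> carrier_vec n" "v \<noteq> 0\<^sub>v n" "A *\<^sub>v v = e \<cdot>\<^sub>v v"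
      unfolding eigenvalue_def eigenvector_def using A by auto
    have "of_real c * (v \<bullet>c v) \<le> e * (v \<bullet>c v)"
      using form[OF v(1)] v by simp
    moreover have "0 < v \<bullet>c v" using v by simp
    ultimately show ?thesis
      by (auto simp: less_eq_complex_def less_complex_def)
  qed
  show "eigvals A = map complex_of_real (map Re (eigvals A))"
  proof -
    have "map (complex_of_real \<circ> Re) (eigvals A) = map id (eigvals A)"
      by (rule map_cong[OF refl]) (use ge in \<open>auto simp: less_eq_complex_def complex_eq_iff\<close>)
    then show ?thesis by simp
  qed
  show "length (map Re (eigvals A)) = n" using length_eigvals[OF A] by simp
  show "c \<le> x" if "x \<in> set (map Re (eigvals A))" for x
    using that ge by (auto simp: less_eq_complex_def)
qed

lemma det_eq_prod_eigvals:
  assumes A: "A \<in> carrier_mat n n"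
  shows "det A = prod_list (eigvals A)"
proof -
  obtain B P Q where dec: "schur_decomposition A (eigvals A) = (B, P, Q)"
    by (rule prod_cases3)
  note wit = schur_decomposition[OF A char_poly_eigvals[OF A] dec]
  then have sim: "similar_mat A B" unfolding similar_mat_def by blast
  moreover have "B \<in> carrier_mat n n" using similar_matD[OF sim] A by auto
  ultimately show ?thesis
    using wit det_similar[OF sim] det_upper_triangular[of B n] by simp
qed

lemma prod_list_of_real: "prod_list (map of_real xs) = (of_real (prod_list xs) :: complex)"
  by (induction xs) auto

lemma complete_symmetric_of_real:
  "complete_symmetric r (map complex_of_real xs) = of_real (complete_symmetric r xs)"
proof -
  have "prod_list (map ((!) (map complex_of_real xs)) idx) = of_real (prod_list (map ((!) xs) idx))"
    if "set idx \<subseteq> {..<length xs}" for idx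
    using that by (induction idx) auto
  then show ?thesis unfolding complete_symmetric_def by (auto intro!: sum.cong)
qed

lemma psd_det_nonneg:
  fixes A :: "complex mat"
  assumes A: "A \<in> carrier_mat n n"
    and form: "\<And>v. v \<in> carrier_vec n \<Longrightarrow> 0 \<le> (A *\<^sub>v v) \<bullet>c v"
  shows "0 \<le> det A"
proof -
  obtain xs where "eigvals A = map complex_of_real xs" "\<And>x. x \<in> set xs \<Longrightarrow> 0 \<le> x"
    using eigvals_bounded_below[of A n 0] assms by (metis mult_zero_left of_real_0)
  then show ?thesis
    by (simp add: det_eq_prod_eigvals[OF A] prod_list_of_real prod_list_nonneg less_eq_complex_def)
qed

lemma det_ge_one:
  fixes A :: "complex mat"
  assumes A: "A \<in> carrier_mat n n"
    and form: "\<And>v. v \<in> carrier_vec n \<Longrightarrow> v \<bullet>c v \<le> (A *\<^sub>v v) \<bullet>c v"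
  shows "1 \<le> det A"
proof -
  obtain xs where xs: "eigvals A = map complex_of_real xs" "\<And>x. x \<in> set xs \<Longrightarrow> 1 \<le> x"
    using eigvals_bounded_below[of A n 1] assms by (metis mult_1 of_real_1)
  have "1 \<le> prod_list xs" using xs(2)
  proof (induction xs)
    case (Cons x xs)
    then have "1 \<le> x" "1 \<le> prod_list xs" by auto
    then have "1 * 1 \<le> x * prod_list xs" by (intro mult_mono) linarith+
    then show ?case by simp
  qed simp
  then show ?thesis
    by (simp add: det_eq_prod_eigvals[OF A] xs(1) prod_list_of_real less_eq_complex_def)
qed

text \<open>This is the one-block case: the eigenvalues are nonnegative reals, and the
  arithmetic-geometric mean inequality applies to them.\<close>

lemma psd_s_eig_ge_det:
  assumes A: "A \<in> carrier_mat k k" and k: "k \<ge> 1"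
    and form: "\<And>v. v \<in> carrier_vec k \<Longrightarrow> 0 \<le> (A *\<^sub>v v) \<bullet>c v"
  shows "(Re (s_eig r A) / ((k + r - 1) choose r)) ^ k \<ge> Re (det A) ^ r"
proof -
  obtain xs where "eigvals A = map complex_of_real xs" "length xs = k" "\<And>x. x \<in> set xs \<Longrightarrow> 0 \<le> x"
    using eigvals_bounded_below[of A k 0] assms by (metis mult_zero_left of_real_0)
  then show ?thesis
    using complete_symmetric_amgm[of xs k r] k
    by (simp add: s_eig_def det_eq_prod_eigvals[OF A] prod_list_of_real complete_symmetric_of_real)
qed

section \<open>Cholesky factors and Gram determinants\<close>

text \<open>Induction on the size by Schur complements: the first row of the factor is read off from
  the first row of \<open>h\<close>, and what remains after subtracting its contribution is again
  positive semidefinite. A zero pivot is allowed, because its whole row then vanishes.\<close>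

lemma cholesky:
  fixes h :: "nat \<Rightarrow> nat \<Rightarrow> complex"
  assumes "\<And>i j. i < m \<Longrightarrow> j < m \<Longrightarrow> h j i = cnj (h i j)"
    and "\<And>v. 0 \<le> (\<Sum>i<m. \<Sum>j<m. cnj (v i) * h i j * v j)"
  shows "\<exists>t. (\<forall>p j. j < p \<longrightarrow> t p j = 0) \<and> (\<forall>i<m. \<forall>j<m. h i j = (\<Sum>p<m. cnj (t p i) * t p j))"
  using assms
proof (induction m arbitrary: h)
  case 0
  show ?case by (intro exI[of _ "\<lambda>_ _. 0"]) simp
next
  case (Suc m)
  note herm = Suc.prems(1) and psd = Suc.prems(2)
  define \<delta> where "\<delta> = Re (h 0 0)"
  define b where "b j = h 0 (Suc j)" for j
  define S where "S v = (\<Sum>i<m. \<Sum>j<m. cnj (v i) * h (Suc i) (Suc j) * v j)" for v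
  have h0: "h 0 0 = of_real \<delta>" using herm[of 0 0] by (simp add: \<delta>_def complex_eq_iff)
  have b_cnj: "h (Suc i) 0 = cnj (b i)" if "i < m" for i
    using herm[of 0 "Suc i"] that by (simp add: b_def)
  \<comment> \<open>The form at the vector with first coordinate \<open>x\<close> followed by
    \<open>v\<close>. Everything below comes from suitable choices of \<open>x\<close>.\<close>
  have expand: "0 \<le> cnj x * of_real \<delta> * x + cnj x * (\<Sum>j<m. b j * v j) + cnj (\<Sum>j<m. b j * v j) * x + S v"
    for x v
  proof -
    have "(\<Sum>i<Suc m. \<Sum>j<Suc m. cnj (case_nat x v i) * h i j * case_nat x v j) =
        cnj x * of_real \<delta> * x + (\<Sum>j<m. cnj x * b j * v j)
        + (\<Sum>i<m. cnj (v i) * h (Suc i) 0 * x + (\<Sum>j<m. cnj (v i) * h (Suc i) (Suc j) * v j))"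
      by (simp add: sum.lessThan_Suc_shift b_def h0 del: sum.lessThan_Suc)
    also have "\<dots> = cnj x * of_real \<delta> * x + cnj x * (\<Sum>j<m. b j * v j)
        + cnj (\<Sum>j<m. b j * v j) * x + S v"
      by (simp add: sum.distrib S_def b_cnj sum_distrib_left sum_distrib_right mult_ac)
    finally show ?thesis using psd[of "case_nat x v"] by simp
  qed
  have \<delta>_nn: "\<delta> \<ge> 0" using expand[of 1 "\<lambda>_. 0"] by (simp add: S_def less_eq_complex_def)
  have b0: "b j = 0" if \<delta>0: "\<delta> = 0" and j: "j < m" for j
  proof (rule ccontr)
    assume nz: "b j \<noteq> 0"
    define e where "e = (\<lambda>i. if i = j then 1 else (0::complex))"
    have be: "(\<Sum>i<m. b i * e i) = b j" using j by (simp add: e_def if_distrib cong: if_cong)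
    \<comment> \<open>With zero pivot the form is affine in \<open>s\<close> with slope
      \<open>- 2 * (cmod (b j))\<^sup>2\<close>; this value of \<open>s\<close> brings it down to
      \<open>- Re (S e) - 2\<close>, which cannot be nonnegative.\<close>
    define s where "s = (Re (S e) + 1) / (cmod (b j))\<^sup>2"
    have "0 \<le> cnj (- of_real s * b j) * b j + cnj (b j) * (- of_real s * b j) + S e"
      using expand[of "- of_real s * b j" e] \<delta>0 by (simp add: be)
    also have "\<dots> = - 2 * of_real s * of_real ((cmod (b j))\<^sup>2) + S e"
      by (simp add: complex_norm_square del: of_real_power)
    finally have "0 \<le> - 2 * s * (cmod (b j))\<^sup>2 + Re (S e)"
      by (simp add: less_eq_complex_def)
    also have "\<dots> = - Re (S e) - 2" using nz by (simp add: s_def)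
    finally have "Re (S e) < 0" by simp
    moreover have "0 \<le> Re (S e)" using expand[of 0 e] by (simp add: less_eq_complex_def)
    ultimately show False by simp
  qed
  define w where "w j = (if \<delta> = 0 then 0 else b j / of_real (sqrt \<delta>))" for j
  define h' where "h' i j = h (Suc i) (Suc j) - cnj (w i) * w j" for i j
  have "\<exists>t. (\<forall>p j. j < p \<longrightarrow> t p j = 0) \<and> (\<forall>i<m. \<forall>j<m. h' i j = (\<Sum>p<m. cnj (t p i) * t p j))"
  proof (rule Suc.IH)
    show "h' j i = cnj (h' i j)" if "i < m" "j < m" for i j
      using herm[of "Suc i" "Suc j"] that by (simp add: h'_def)
    fix v
    define \<beta> where "\<beta> = (\<Sum>j<m. b j * v j)"
    have "cnj (\<Sum>j<m. w j * v j) * (\<Sum>j<m. w j * v j) =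
        (\<Sum>i<m. \<Sum>j<m. cnj (v i) * (cnj (w i) * w j) * v j)"
      by (simp only: cnj_sum sum_product) (simp add: mult_ac)
    then have "(\<Sum>i<m. \<Sum>j<m. cnj (v i) * h' i j * v j) = S v - cnj (\<Sum>j<m. w j * v j) * (\<Sum>j<m. w j * v j)"
      by (simp add: h'_def S_def right_diff_distrib left_diff_distrib sum_subtractf)
    moreover have "0 \<le> S v - cnj (\<Sum>j<m. w j * v j) * (\<Sum>j<m. w j * v j)"
    proof (cases "\<delta> = 0")
      case True
      then show ?thesis using expand[of 0 v] by (simp add: w_def)
    next
      case False
      have w: "(\<Sum>j<m. w j * v j) = \<beta> / of_real (sqrt \<delta>)"
        using False by (simp add: w_def \<beta>_def sum_divide_distrib)
      have sq: "of_real (sqrt \<delta>) * of_real (sqrt \<delta>) = (of_real \<delta> :: complex)"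
        using \<delta>_nn by (simp flip: of_real_mult)
      \<comment> \<open>The choice \<open>x = - \<beta> / \<delta>\<close> minimises the form in the
        first coordinate, and the minimum is the form of the Schur complement.\<close>
      have "0 \<le> cnj (- \<beta> / of_real \<delta>) * of_real \<delta> * (- \<beta> / of_real \<delta>) + cnj (- \<beta> / of_real \<delta>) * \<beta>
          + cnj \<beta> * (- \<beta> / of_real \<delta>) + S v"
        using expand[of "- \<beta> / of_real \<delta>" v] unfolding \<beta>_def .
      also have "\<dots> = S v - cnj \<beta> * \<beta> / of_real \<delta>"
        using False by (simp add: field_simps)
      finally show ?thesis by (simp add: w sq)
    qed
    ultimately show "0 \<le> (\<Sum>i<m. \<Sum>j<m. cnj (v i) * h' i j * v j)" by simp
  qed
  then obtain t where t0: "\<And>p j. j < p \<Longrightarrow> t p j = 0"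
    and t: "\<And>i j. i < m \<Longrightarrow> j < m \<Longrightarrow> h' i j = (\<Sum>p<m. cnj (t p i) * t p j)" by blast
  \<comment> \<open>The factor of the complement is bordered by the new first row and by zeros below
    its pivot.\<close>
  define u where "u p j = (case p of 0 \<Rightarrow> (case j of 0 \<Rightarrow> of_real (sqrt \<delta>) | Suc j' \<Rightarrow> w j')
      | Suc p' \<Rightarrow> (case j of 0 \<Rightarrow> 0 | Suc j' \<Rightarrow> t p' j'))" for p j
  have "u p j = 0" if "j < p" for p j
    using that t0 by (auto simp: u_def split: nat.split)
  moreover have "h i j = (\<Sum>p<Suc m. cnj (u p i) * u p j)" if ij: "i < Suc m" "j < Suc m" for i j
  proof -
    have sq: "of_real (sqrt \<delta>) * of_real (sqrt \<delta>) = (of_real \<delta> :: complex)"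
      using \<delta>_nn by (simp flip: of_real_mult)
    have sw: "of_real (sqrt \<delta>) * w l = b l" if "l < m" for l
      using b0[OF _ that] \<delta>_nn by (simp add: w_def)
    have "h i j = cnj (u 0 i) * u 0 j + (\<Sum>p<m. cnj (u (Suc p) i) * u (Suc p) j)"
    proof (cases i)
      case 0
      then show ?thesis using sq sw ij by (cases j) (auto simp: u_def h0 b_def)
    next
      case (Suc i')
      have "cnj (w i') * of_real (sqrt \<delta>) = cnj (b i')"
        using arg_cong[OF sw[of i'], of cnj] ij Suc by (simp add: mult.commute)
      then show ?thesis
        using Suc ij b_cnj t[of i'] by (cases j) (auto simp: u_def h'_def algebra_simps)
    qed
    then show ?thesis by (simp add: sum.lessThan_Suc_shift del: sum.lessThan_Suc)
  qed
  ultimately show ?case by blast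
qed

lemma det_cholesky:
  fixes t :: "nat \<Rightarrow> nat \<Rightarrow> complex"
  assumes t0: "\<And>p j. p < m \<Longrightarrow> j < p \<Longrightarrow> t p j = 0"
  shows "det (mat m m (\<lambda>(i, j). \<Sum>p<m. cnj (t p i) * t p j)) = of_real (\<Prod>p<m. (cmod (t p p))\<^sup>2)"
proof -
  define L U where "L = mat m m (\<lambda>(i, p). cnj (t p i))" and "U = mat m m (\<lambda>(p, j). t p j)"
  have c: "L \<in> carrier_mat m m" "U \<in> carrier_mat m m" by (simp_all add: L_def U_def)
  have "mat m m (\<lambda>(i, j). \<Sum>p<m. cnj (t p i) * t p j) = L * U"
  proof (rule eq_matI)
    fix i j assume "i < dim_row (L * U)" "j < dim_col (L * U)"
    then have ij: "i < m" "j < m" by (simp_all add: L_def U_def)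
    then show "mat m m (\<lambda>(i, j). \<Sum>p<m. cnj (t p i) * t p j) $$ (i, j) = (L * U) $$ (i, j)"
      unfolding mult_mat_entry[OF c ij] by (simp add: L_def U_def)
  qed (simp_all add: L_def U_def)
  moreover have "det L = (\<Prod>p<m. cnj (t p p))"
    by (subst det_lower_triangular[OF _ c(1)])
       (auto simp: L_def t0 prod_list_diag_prod lessThan_atLeast0)
  moreover have "det U = (\<Prod>p<m. t p p)"
    by (subst det_upper_triangular[OF _ c(2)])
       (auto simp: U_def t0 upper_triangular_def prod_list_diag_prod lessThan_atLeast0)
  ultimately show ?thesis
    by (simp only: det_mult[OF c] of_real_prod of_real_cmod_square prod.distrib)
qed

(* The matrix U below holds the coordinate of each v j along the normalised restriction of v i
   to W i. It is upper triangular, and G >= U* U by Cauchy-Schwarz on each W i; hence Q* G Q >= 1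
   for the inverse Q of U. *)
lemma det_gram_ge:
  fixes v :: "nat \<Rightarrow> 'b \<Rightarrow> complex"
  assumes fin: "finite \<Omega>"
    and sub: "\<And>i. i < n \<Longrightarrow> W i \<subseteq> \<Omega>"
    and disj: "\<And>i j. i < n \<Longrightarrow> j < n \<Longrightarrow> i \<noteq> j \<Longrightarrow> W i \<inter> W j = {}"
    and vanish: "\<And>i j \<omega>. i < n \<Longrightarrow> j < i \<Longrightarrow> \<omega> \<in> W i \<Longrightarrow> v j \<omega> = 0"
  shows "of_real (\<Prod>i<n. \<Sum>\<omega>\<in>W i. (cmod (v i \<omega>))\<^sup>2) \<le>
    det (mat n n (\<lambda>(i, j). \<Sum>\<omega>\<in>\<Omega>. cnj (v i \<omega>) * v j \<omega>))"
proof -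
  define G where "G = mat n n (\<lambda>(i, j). \<Sum>\<omega>\<in>\<Omega>. cnj (v i \<omega>) * v j \<omega>)"
  define s where "s i = (\<Sum>\<omega>\<in>W i. (cmod (v i \<omega>))\<^sup>2)" for i
  have G: "G \<in> carrier_mat n n" by (simp add: G_def)
  have s_nn: "0 \<le> s i" for i unfolding s_def by (intro sum_nonneg) simp
  show ?thesis
    unfolding s_def[symmetric] G_def[symmetric]
  \<comment> \<open>If some \<open>s i\<close> vanishes, the lower bound is 0 and nonnegativity of
    the Gram determinant suffices; otherwise the restrictions can be normalised.\<close>
  proof (cases "\<exists>i<n. s i = 0")
    case True
    then have "(\<Prod>i<n. s i) = 0" by auto
    moreover have "0 \<le> det G"
      by (rule psd_det_nonneg[OF G], unfold G_def, subst gram_form)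
         (auto simp: less_eq_complex_def intro!: sum_nonneg)
    ultimately show "of_real (\<Prod>i<n. s i) \<le> det G" by (simp only: of_real_0)
  next
    case False
    then have s_pos: "0 < s i" if "i < n" for i using that s_nn[of i] by (metis less_eq_real_def)
    define U where "U = mat n n (\<lambda>(i, j). (\<Sum>\<omega>\<in>W i. cnj (v i \<omega>) * v j \<omega>) / of_real (sqrt (s i)))"
    have U: "U \<in> carrier_mat n n" by (simp add: U_def)
    have "det U = (\<Prod>i<n. (\<Sum>\<omega>\<in>W i. cnj (v i \<omega>) * v i \<omega>) / of_real (sqrt (s i)))"
      by (subst det_upper_triangular[OF _ U])
         (auto simp: U_def vanish upper_triangular_def prod_list_diag_prod lessThan_atLeast0)
    also have "\<dots> = (\<Prod>i<n. of_real (sqrt (s i)))"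
    proof (rule prod.cong[OF refl])
      fix i assume "i \<in> {..<n}"
      then have "0 < s i" using s_pos by simp
      have "(\<Sum>\<omega>\<in>W i. cnj (v i \<omega>) * v i \<omega>) = of_real (s i)"
        by (simp add: s_def complex_norm_square mult.commute del: of_real_power)
      also have "\<dots> = of_real (sqrt (s i)) * of_real (sqrt (s i))"
        using s_nn[of i] by (simp flip: of_real_mult)
      finally show "(\<Sum>\<omega>\<in>W i. cnj (v i \<omega>) * v i \<omega>) / of_real (sqrt (s i)) = of_real (sqrt (s i))"
        using \<open>0 < s i\<close> by simp
    qed
    finally have det_U: "det U = of_real (\<Prod>i<n. sqrt (s i))" by simp
    have P_pos: "0 < (\<Prod>i<n. sqrt (s i))" using s_pos by (intro prod_pos) simp
    have "U \<in> Units (ring_mat TYPE(complex) n ())"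
      using det_U P_pos by (intro det_non_zero_imp_unit[OF U]) (metis of_real_eq_0_iff less_irrefl)
    then obtain Q where Q: "Q \<in> carrier_mat n n" and UQ: "U * Q = 1\<^sub>m n"
      unfolding Units_def ring_mat_def by auto
    interpret cnj: comm_ring_hom cnj by unfold_locales simp_all
    define R where "R = transpose_mat (map_mat cnj Q)"
    have R: "R \<in> carrier_mat n n" using Q by (simp add: R_def)
    have det_R: "det R = cnj (det Q)"
      unfolding R_def using Q by (subst det_transpose[of _ n]) simp_all
    have RGQ: "R * (G * Q) \<in> carrier_mat n n" using R G Q by simp
    \<comment> \<open>\<open>R\<close> is the adjoint of \<open>Q\<close>, so the form of
      \<open>R * (G * Q)\<close> at \<open>x\<close> is the form of \<open>G\<close> at
      \<open>Q *\<^sub>v x\<close>.\<close>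
    have adj: "(R *\<^sub>v y) \<bullet>c x = y \<bullet>c (Q *\<^sub>v x)"
      if y: "y \<in> carrier_vec n" and x: "x \<in> carrier_vec n" for x y
    proof -
      have "(R *\<^sub>v y) \<bullet>c x = (\<Sum>i<n. \<Sum>j<n. cnj (x $ i) * cnj (Q $$ (j, i)) * y $ j)"
        unfolding cscalar_prod_sum[OF R y x] using Q by (simp add: R_def)
      also have "\<dots> = (\<Sum>j<n. \<Sum>i<n. cnj (x $ i) * cnj (Q $$ (j, i)) * y $ j)" by (rule sum.swap)
      also have "\<dots> = (\<Sum>j<n. y $ j * cnj ((Q *\<^sub>v x) $ j))"
        by (simp add: mult_mat_vec_entry[OF Q x] sum_distrib_left mult_ac)
      also have "\<dots> = y \<bullet>c (Q *\<^sub>v x)"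
        using Q x y by (simp add: scalar_prod_def lessThan_atLeast0)
      finally show ?thesis .
    qed
    have "1 \<le> det (R * (G * Q))"
    proof (rule det_ge_one[OF RGQ])
      fix x :: "complex vec" assume x: "x \<in> carrier_vec n"
      define y where "y = Q *\<^sub>v x"
      have y: "y \<in> carrier_vec n" using Q x by (simp add: y_def)
      define z where "z \<omega> = (\<Sum>j<n. y $ j * v j \<omega>)" for \<omega>
      have "U *\<^sub>v y = (U * Q) *\<^sub>v x" unfolding y_def using U Q x by simp
      then have x_eq: "x = U *\<^sub>v y" using UQ x by simp
      \<comment> \<open>Since \<open>x = U *\<^sub>v y\<close>, the entry \<open>x $ i\<close> is
        the coordinate of \<open>z\<close> along the normalised restriction of \<open>v i\<close> to
        \<open>W i\<close>; Cauchy-Schwarz bounds it by the norm of \<open>z\<close> on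
        \<open>W i\<close>.\<close>
      have bound: "(cmod (x $ i))\<^sup>2 \<le> (\<Sum>\<omega>\<in>W i. (cmod (z \<omega>))\<^sup>2)" if i: "i < n" for i
      proof -
        have "x $ i = (\<Sum>j<n. U $$ (i, j) * y $ j)"
          by (subst x_eq) (rule mult_mat_vec_entry[OF U y i])
        also have "\<dots> = (\<Sum>j<n. \<Sum>\<omega>\<in>W i. cnj (v i \<omega>) * (y $ j * v j \<omega>)) / of_real (sqrt (s i))"
          using i by (simp add: U_def sum_distrib_left sum_divide_distrib mult_ac)
        also have "(\<Sum>j<n. \<Sum>\<omega>\<in>W i. cnj (v i \<omega>) * (y $ j * v j \<omega>)) = (\<Sum>\<omega>\<in>W i. cnj (v i \<omega>) * z \<omega>)"
          by (subst sum.swap) (simp add: z_def sum_distrib_left)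
        finally have "cmod (x $ i) = cmod (\<Sum>\<omega>\<in>W i. cnj (v i \<omega>) * z \<omega>) / sqrt (s i)"
          using s_nn[of i] by (simp add: norm_divide)
        also have "\<dots> \<le> (\<Sum>\<omega>\<in>W i. cmod (v i \<omega>) * cmod (z \<omega>)) / sqrt (s i)"
          using s_nn[of i] by (intro divide_right_mono order_trans[OF norm_sum]) (simp_all add: norm_mult)
        finally have "(cmod (x $ i))\<^sup>2 \<le> ((\<Sum>\<omega>\<in>W i. cmod (v i \<omega>) * cmod (z \<omega>)) / sqrt (s i))\<^sup>2"
          by (intro power_mono) simp_all
        also have "\<dots> = (\<Sum>\<omega>\<in>W i. cmod (v i \<omega>) * cmod (z \<omega>))\<^sup>2 / s i"
          using s_nn[of i] by (simp add: power_divide)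
        also have "\<dots> \<le> s i * (\<Sum>\<omega>\<in>W i. (cmod (z \<omega>))\<^sup>2) / s i"
          unfolding s_def by (intro divide_right_mono Cauchy_Schwarz_ineq_sum sum_nonneg) simp
        finally show ?thesis using s_pos[OF i] by simp
      qed
      have "(\<Sum>i<n. (cmod (x $ i))\<^sup>2) \<le> (\<Sum>i<n. \<Sum>\<omega>\<in>W i. (cmod (z \<omega>))\<^sup>2)"
        using bound by (intro sum_mono) simp
      \<comment> \<open>As the sets \<open>W i\<close> are disjoint, the squared norms of
        \<open>z\<close> on them add up to at most its squared norm on \<Omega>.\<close>
      also have "\<dots> = (\<Sum>\<omega>\<in>(\<Union>i<n. W i). (cmod (z \<omega>))\<^sup>2)"
        using disj finite_subset[OF sub fin] by (intro sum.UNION_disjoint[symmetric]) auto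
      also have "\<dots> \<le> (\<Sum>\<omega>\<in>\<Omega>. (cmod (z \<omega>))\<^sup>2)"
        using sub by (intro sum_mono2 fin) auto
      finally have "x \<bullet>c x \<le> (G *\<^sub>v y) \<bullet>c y"
        unfolding cscalar_prod_self[OF x] G_def gram_form[OF y] z_def
        by (simp add: less_eq_complex_def)
      also have "(G *\<^sub>v y) \<bullet>c y = (R *\<^sub>v (G *\<^sub>v y)) \<bullet>c x"
        using adj[of "G *\<^sub>v y" x] G y x by (simp add: y_def)
      also have "R *\<^sub>v (G *\<^sub>v y) = (R * (G * Q)) *\<^sub>v x"
        using assoc_mult_mat_vec[OF R _ x, of "G * Q"] assoc_mult_mat_vec[OF G Q x] G Q
        by (simp add: y_def)
      finally show "x \<bullet>c x \<le> (R * (G * Q) *\<^sub>v x) \<bullet>c x" .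
    qed
    then have ge1: "1 \<le> cnj (det Q) * det Q * det G"
      unfolding det_mult[OF R mult_carrier_mat[OF G Q]] det_mult[OF G Q] det_R
      by (simp only: mult_ac)
    have UQ1: "det U * det Q = 1"
      using arg_cong[OF UQ, of det] by (simp add: det_mult[OF U Q])
    define a where "a = (\<Prod>i<n. sqrt (s i))"
    have "a > 0" using P_pos by (simp add: a_def)
    have "of_real a * det Q = 1" using UQ1 by (simp only: det_U a_def)
    then have dQ: "det Q = of_real (1 / a)"
      using \<open>a > 0\<close> by (simp add: field_simps)
    have "a\<^sup>2 = (\<Prod>i<n. s i)"
      unfolding a_def prod_power_distrib using s_nn by simp
    have "1 \<le> of_real (1 / a\<^sup>2) * det G"
      using ge1 by (simp add: dQ power2_eq_square)
    then have "of_real (a\<^sup>2) * 1 \<le> of_real (a\<^sup>2) * (of_real (1 / a\<^sup>2) * det G)"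
      by (intro mult_left_mono) (auto simp: less_eq_complex_def)
    also have "\<dots> = det G" using \<open>a > 0\<close> by simp
    finally show "of_real (\<Prod>i<n. s i) \<le> det G" unfolding \<open>a\<^sup>2 = _\<close> by simp
  qed
qed

lemma complex_of_real_le_iff: "complex_of_real x \<le> complex_of_real y \<longleftrightarrow> x \<le> y"
  by (simp add: less_eq_complex_def)

section \<open>The determinantal inequality for block matrices\<close>

theorem theorem3p7:
  fixes n k r :: nat and H :: "complex mat"
  assumes "n \<ge> 1" and "k \<ge> 1" and "r \<ge> 1"
    and "H \<in> carrier_mat (n * k) (n * k)"
    and "positive_semidefinite H"
  shows "(det (mat n n (\<lambda>(i, j). s_eig r (block k H i j)))
            / of_nat ((k + r - 1) choose r) ^ n) ^ k \<ge> det H ^ r"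
proof -
  note H = assms(4)
  define N where "N = (k + r - 1) choose r"
  have N_pos: "0 < N" using assms(2) by (simp add: N_def)
  have herm: "H $$ (j, i) = cnj (H $$ (i, j))" if "i < n * k" "j < n * k" for i j
  proof -
    have "mat_adjoint H $$ (j, i) = cnj (H $$ (i, j))"
      using H that by (simp add: mat_adjoint_def mat_of_rows_index)
    then show ?thesis using assms(5) by (simp add: positive_semidefinite_def)
  qed
  have psd: "0 \<le> (\<Sum>i<n * k. \<Sum>j<n * k. cnj (v i) * H $$ (i, j) * v j)" for v
  proof -
    have "0 \<le> (H *\<^sub>v vec (n * k) v) \<bullet>c vec (n * k) v"
      using assms(5) H by (simp add: positive_semidefinite_def)
    then show ?thesis by (simp add: cscalar_prod_sum[OF H])
  qed
  obtain t where t0: "\<And>p j. j < p \<Longrightarrow> t p j = 0"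
    and t: "\<And>i j. i < n * k \<Longrightarrow> j < n * k \<Longrightarrow> H $$ (i, j) = (\<Sum>p<n * k. cnj (t p i) * t p j)"
    using cholesky[of "n * k" "\<lambda>i j. H $$ (i, j)", OF herm psd] by blast
  have index: "i * k + a < n * k" if "i < n" "a < k" for i a
  proof -
    have "i * k + a < (i + 1) * k" using that by simp
    also have "\<dots> \<le> n * k" using that by (intro mult_le_mono1) simp
    finally show ?thesis .
  qed

  \<comment> \<open>\<open>D i\<close> is the squared modulus of the determinant of the i-th
    diagonal block of the triangular factor.\<close>
  define D where "D i = (\<Prod>a<k. (cmod (t (i * k + a) (i * k + a)))\<^sup>2)" for i
  have "det H = det (mat (n * k) (n * k) (\<lambda>(i, j). \<Sum>p<n * k. cnj (t p i) * t p j))"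
    using H t by (intro arg_cong[of _ _ det] eq_matI) auto
  also have "\<dots> = of_real (\<Prod>p<n * k. (cmod (t p p))\<^sup>2)" by (rule det_cholesky) (rule t0)
  also have "(\<Prod>p<n * k. (cmod (t p p))\<^sup>2) = (\<Prod>i<n. D i)"
    unfolding D_def prod.nat_group[symmetric]
  proof (rule prod.cong[OF refl])
    fix i
    show "(\<Prod>p\<in>{i * k..<i * k + k}. (cmod (t p p))\<^sup>2) =
        (\<Prod>a<k. (cmod (t (i * k + a) (i * k + a)))\<^sup>2)"
      by (rule prod.reindex_bij_witness[where i = "\<lambda>a. i * k + a" and j = "\<lambda>p. p - i * k"]) auto
  qed
  finally have det_H: "det H = of_real (\<Prod>i<n. D i)" .

  define F where "F = {..<r} \<rightarrow>\<^sub>E {..<k}"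
  define rows where "rows i = {i * k..<i * k + k}" for i
  define T where "T i p a = t p (i * k + a)" for i p a
  \<comment> \<open>One factor r! comes from \<open>s_eig_sym_trace\<close> and another from
    \<open>sym_trace_gram\<close>; they are shared equally between the two arguments of the inner
    product.\<close>
  define v where "v i = (\<lambda>(g, f). sym_power r (T i) g f / fact r)" for i
  define W where "W R = ({..<r} \<rightarrow>\<^sub>E R) \<times> F" for R :: "nat set"
  have s_eig_gram: "s_eig r A = (\<Sum>\<omega>\<in>W R. cnj (v i \<omega>) * v j \<omega>)"
    if A: "A \<in> carrier_mat k k" and R: "finite R"
      and entry: "\<And>a b. a < k \<Longrightarrow> b < k \<Longrightarrow> A $$ (a, b) = (\<Sum>p\<in>R. cnj (T i p a) * T j p b)"
    for A R i j
  proof -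
    have "fact r * s_eig r A = sym_trace r k (\<lambda>a b. \<Sum>p\<in>R. cnj (T i p a) * T j p b)"
      unfolding s_eig_sym_trace[OF A] by (rule sym_trace_cong) (rule entry)
    then have "fact r * (fact r * s_eig r A) =
        (\<Sum>(g, f) \<in> W R. cnj (sym_power r (T i) g f) * sym_power r (T j) g f)"
      by (simp only: sym_trace_gram[OF R] W_def F_def)
    then have "s_eig r A =
        (\<Sum>(g, f) \<in> W R. cnj (sym_power r (T i) g f) * sym_power r (T j) g f) / (fact r * fact r)"
      by (metis (no_types, lifting) fact_nonzero mult.assoc mult_eq_0_iff nonzero_mult_div_cancel_left)
    also have "\<dots> = (\<Sum>\<omega>\<in>W R. cnj (v i \<omega>) * v j \<omega>)"
      unfolding sum_divide_distrib by (intro sum.cong refl) (auto simp: v_def)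
    finally show ?thesis .
  qed

  define G where "G = mat n n (\<lambda>(i, j). s_eig r (block k H i j))"
  have G_eq: "G = mat n n (\<lambda>(i, j). \<Sum>\<omega>\<in>W {..<n * k}. cnj (v i \<omega>) * v j \<omega>)"
    unfolding G_def
  proof (rule cong_mat[OF refl refl], clarsimp)
    fix i j assume "i < n" "j < n"
    then show "s_eig r (block k H i j) = (\<Sum>\<omega>\<in>W {..<n * k}. cnj (v i \<omega>) * v j \<omega>)"
      by (intro s_eig_gram) (simp_all add: block_def t index T_def)
  qed

  \<comment> \<open>The Gram matrix of the i-th diagonal block of the factor: its determinant is
    \<open>D i\<close>, and its s_r is the squared norm of \<open>v i\<close> on
    \<open>W (rows i)\<close>.\<close>
  define P where "P i = mat k k (\<lambda>(a, b). \<Sum>p\<in>rows i. cnj (T i p a) * T i p b)" for i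
  define s where "s i = (\<Sum>\<omega>\<in>W (rows i). (cmod (v i \<omega>))\<^sup>2)" for i
  have P: "P i \<in> carrier_mat k k" for i by (simp add: P_def)
  have s_P: "s_eig r (P i) = of_real (s i)" for i
  proof -
    have "s_eig r (P i) = (\<Sum>\<omega>\<in>W (rows i). cnj (v i \<omega>) * v i \<omega>)"
      by (rule s_eig_gram[OF P]) (simp_all add: P_def rows_def)
    then show ?thesis by (simp only: s_def of_real_sum of_real_cmod_square)
  qed
  have det_P: "det (P i) = of_real (D i)" for i
  proof -
    have "(\<Sum>p\<in>rows i. h p) = (\<Sum>c<k. h (i * k + c))" for h :: "nat \<Rightarrow> complex"
      unfolding rows_def
      by (rule sum.reindex_bij_witness[where i = "\<lambda>c. i * k + c" and j = "\<lambda>p. p - i * k"]) auto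
    then have P_eq: "P i =
        mat k k (\<lambda>(a, b). \<Sum>c<k. cnj (t (i * k + c) (i * k + a)) * t (i * k + c) (i * k + b))"
      by (simp add: P_def T_def)
    show ?thesis unfolding P_eq D_def by (rule det_cholesky) (rule t0, simp)
  qed
  have D_nn: "0 \<le> D i" for i unfolding D_def by (intro prod_nonneg) simp
  have s_nn: "0 \<le> s i" for i unfolding s_def by (intro sum_nonneg) simp
  have s_ge: "D i ^ r \<le> (s i / N) ^ k" for i
  proof -
    have "0 \<le> (P i *\<^sub>v x) \<bullet>c x" if "x \<in> carrier_vec k" for x
      unfolding P_def gram_form[OF that, where v = "\<lambda>a p. T i p a"]
      by (auto simp: less_eq_complex_def intro!: sum_nonneg)
    then show ?thesis
      using psd_s_eig_ge_det[OF P assms(2), of i r] by (simp add: s_P det_P N_def)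
  qed

  have det_G: "of_real (\<Prod>i<n. s i) \<le> det G"
    unfolding G_eq s_def
  proof (rule det_gram_ge, goal_cases)
    case 1
    show ?case
      unfolding W_def F_def by (intro finite_cartesian_product finite_PiE) simp_all
  next
    case (2 i)
    then have "rows i \<subseteq> {..<n * k}" using index[of i] by (force simp: rows_def le_iff_add)
    then show ?case
      unfolding W_def by (intro Sigma_mono PiE_mono subset_refl)
  next
    case (3 i j)
    have "rows i \<inter> rows j = {}"
    proof -
      have "p div k = i" if "p \<in> rows i" for p i
        using that assms(2) by (intro div_nat_eqI) (auto simp: rows_def mult.commute)
      then show ?thesis using 3(3) by blast
    qed
    \<comment> \<open>Because r is positive, \<open>g 0\<close> is a genuine value of
      \<open>g\<close>, and the block containing it tells the sets \<open>W (rows i)\<close>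
      apart.\<close>
    moreover have "g 0 \<in> rows i" if "(g, f) \<in> W (rows i)" for g f i
      using that assms(3) PiE_mem[of g "{..<r}" "\<lambda>_. rows i" 0] by (simp add: W_def)
    ultimately show ?case by (metis disjoint_iff surj_pair)
  next
    case (4 i j \<omega>)
    then have ij: "j < i" and \<omega>: "\<omega> \<in> W (rows i)" by simp_all
    obtain g f where gf: "\<omega> = (g, f)" by force
    have g: "g 0 \<in> rows i" and f: "f \<in> F"
      using \<omega> assms(3) PiE_mem[of g "{..<r}" "\<lambda>_. rows i" 0] by (simp_all add: gf W_def)
    \<comment> \<open>The factor at l = 0 already vanishes: its row lies in block \<open>i\<close>
      and its column in the earlier block \<open>j\<close>, hence below the diagonal of
      \<open>t\<close>.\<close>
    have "(\<Prod>l<r. T j (g l) (f (\<tau> l))) = 0" if "\<tau> permutes {..<r}" for \<tau>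
    proof -
      have "\<tau> 0 \<in> {..<r}" using permutes_in_image[OF that, of 0] assms(3) by simp
      then have "f (\<tau> 0) < k" using f PiE_mem[of f "{..<r}" "\<lambda>_. {..<k}" "\<tau> 0"] by (simp add: F_def)
      then have "j * k + f (\<tau> 0) < (j + 1) * k" by simp
      also have "\<dots> \<le> i * k" using ij by (intro mult_le_mono1) simp
      also have "\<dots> \<le> g 0" using g by (simp add: rows_def)
      finally have "T j (g 0) (f (\<tau> 0)) = 0" unfolding T_def by (rule t0)
      then show ?thesis using assms(3) by (intro prod_zero) auto
    qed
    then have "sym_power r (T j) g f = 0"
      unfolding sym_power_def by (intro sum.neutral) blast
    then show ?case by (simp add: v_def gf)
  qed

  \<comment> \<open>By the complex order the bound \<open>det_G\<close> also says that
    \<open>det G\<close> is real, so the remaining chain takes place in the reals.\<close>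
  define d where "d = Re (det G)"
  have d: "det G = of_real d" "(\<Prod>i<n. s i) \<le> d"
    using det_G by (simp_all add: d_def less_eq_complex_def complex_eq_iff del: of_real_prod)
  have "(\<Prod>i<n. D i) ^ r = (\<Prod>i<n. D i ^ r)" by (rule prod_power_distrib)
  also have "\<dots> \<le> (\<Prod>i<n. (s i / N) ^ k)"
    using s_ge D_nn by (intro prod_mono) simp
  also have "\<dots> = ((\<Prod>i<n. s i) / N ^ n) ^ k"
    by (simp add: prod_power_distrib[symmetric] prod_dividef)
  also have "\<dots> \<le> (d / N ^ n) ^ k"
    using s_nn d(2) by (intro power_mono divide_right_mono divide_nonneg_nonneg prod_nonneg) simp_all
  finally have "of_real ((\<Prod>i<n. D i) ^ r) \<le> complex_of_real ((d / N ^ n) ^ k)"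
    by (simp only: complex_of_real_le_iff)
  then have "det H ^ r \<le> (det G / of_nat N ^ n) ^ k"
    by (simp add: det_H d(1))
  then show ?thesis by (simp only: G_def N_def)
qed

end
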